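(* Let $n\ge 2$ be an integer and let $a,c\in[0,\pi]$. A spherical antiprism $\mathcal{A}_n(a,c)$ in $\mathbb{S}^3$ with symmetry group $S_{2n}$ (possibly degenerate) exists if and only if the following conditions hold: \begin{align*} 1+ \cos a - 2\left(1+\cos\frac{\pi}{n}\right)\cos c+2 \cos \frac{\pi}{n}&\geq 0,\\ 1+ \cos a + 2\left(1-\cos\frac{\pi}{n}\right)\cos c-2 \cos \frac{\pi}{n}&\geq 0,\\ \cos a - \cos \frac{2\pi}{n}&\geq0. \end{align*}
   Context: $\mathbb{S}^3$ is the three-dimensional spherical space of constant curvature $1$. A spherical antiprism $\mathcal{A}_n$ is a convex polyhedron in $\mathbb{S}^3$ with $2n$ vertices, having two equal regular $n$-gons as the top and bottom faces and $2n$ equal (isosceles) triangles as lateral faces. It has the symmetry group $S_{2n}$ generated by a mirror-rotational symmetry $\sigma$ of order $2n$: the composition of the rotation by angle $\pi/n$ about the axis passing through the centres of the top and bottom faces and the reflection in a plane (great 2-sphere) perpendicular to this axis. $\mathcal{A}_n(a,c)$ denotes the antiprism in which the edges of the top and bottom $n$-gons have length $a$ and the lateral edges have length $c$. Thus the vertices are $v_0,\dots,v_{2n-1}$ with $v_{j+1}=\sigma(v_j)$ (indices mod $2n$), where the spherical distance between $v_j$ and $v_{j+2}$ equals $a$ and that between $v_j$ and $v_{j+1}$ equals $c$. For $n=2$ the top and bottom $n$-gons degenerate to two skew edges of length $a$, and the antiprism is a tetrahedron. Convention on degenerate cases: existence is understood in the closed sense, i.e. degenerate configurations of points $v_0,\dots,v_{2n-1}\in\mathbb{S}^3$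 satisfying $v_{j+1}=\sigma(v_j)$ (indices mod $2n$), where $\sigma$ is the composition of the rotation by angle $\pi/n$ about an axis (a great circle) and the reflection in a great 2-sphere perpendicular to this axis, with spherical distance $a$ between $v_j$ and $v_{j+2}$ and spherical distance $c$ between $v_j$ and $v_{j+1}$ for all $j$ (in which the antiprism loses dimension, e.g. degenerating to a spherical segment when $a=0$, or to a spherical $2n$-gon when the centres of the two bases coincide) are admitted as limiting cases; these are the cases of equality. *)

theory Defs
  imports "HOL-Analysis.Analysis"
begin

definition S3 :: "(real^4) set" where
  "S3 = sphere 0 1"

definition sph_dist :: "real^4 \<Rightarrow> real^4 \<Rightarrow> real" where
  "sph_dist x y = arccos (x \<bullet> y)"

definition great_circle :: "(real^4) set \<Rightarrow> bool" where
  "great_circle C \<longleftrightarrow> (\<exists>P. subspace P \<and> dim P = 2 \<and> C = P \<inter> S3)"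

definition great_two_sphere :: "(real^4) set \<Rightarrow> bool" where
  "great_two_sphere M \<longleftrightarrow> (\<exists>H. subspace H \<and> dim H = 3 \<and> M = H \<inter> S3)"

(* The tangent space at p of a great subsphere X consists of the vectors of span X orthogonal
   to p.  A great circle and a great 2-sphere always meet, so the condition is never vacuous. *)
definition perpendicular :: "(real^4) set \<Rightarrow> (real^4) set \<Rightarrow> bool" where
  "perpendicular C M \<longleftrightarrow>
     (\<forall>p \<in> C \<inter> M. \<forall>t \<in> span C. \<forall>s \<in> span M.
        orthogonal t p \<longrightarrow> orthogonal s p \<longrightarrow> orthogonal t s)"

(* Isometries of S3 are represented by their unique linear extensions to real^4. *)
definition rotation_about :: "(real^4) set \<Rightarrow> real \<Rightarrow> (real^4 \<Rightarrow> real^4) \<Rightarrow> bool" where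
  "rotation_about C \<theta> \<rho> \<longleftrightarrow>
     linear \<rho> \<and> (\<forall>x \<in> span C. \<rho> x = x) \<and>
     (\<exists>e f. e \<in> orthogonal_comp (span C) \<and> f \<in> orthogonal_comp (span C) \<and>
        norm e = 1 \<and> norm f = 1 \<and> orthogonal e f \<and>
        \<rho> e = cos \<theta> *\<^sub>R e + sin \<theta> *\<^sub>R f \<and>
        \<rho> f = - sin \<theta> *\<^sub>R e + cos \<theta> *\<^sub>R f)"

definition reflection_in :: "(real^4) set \<Rightarrow> (real^4 \<Rightarrow> real^4) \<Rightarrow> bool" where
  "reflection_in M \<tau> \<longleftrightarrow>
     linear \<tau> \<and> (\<forall>x \<in> span M. \<tau> x = x) \<and> (\<forall>x \<in> orthogonal_comp (span M). \<tau> x = - x)"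

definition mirror_rotation :: "nat \<Rightarrow> (real^4 \<Rightarrow> real^4) \<Rightarrow> bool" where
  "mirror_rotation n \<sigma> \<longleftrightarrow>
     (\<exists>C M \<rho> \<tau>. great_circle C \<and> great_two_sphere M \<and> perpendicular C M \<and>
        rotation_about C (pi / real n) \<rho> \<and> reflection_in M \<tau> \<and> \<sigma> = \<tau> \<circ> \<rho>)"

(* A possibly degenerate antiprism is given by its cyclically labelled vertices: v j with j even
   are the vertices of one base and those with j odd the vertices of the other.  Coinciding or
   lower-dimensional vertex configurations are allowed. *)
definition spherical_antiprism ::
    "nat \<Rightarrow> real \<Rightarrow> real \<Rightarrow> (real^4 \<Rightarrow> real^4) \<Rightarrow> (nat \<Rightarrow> real^4) \<Rightarrow> bool" where
  "spherical_antiprism n a c \<sigma> v \<longleftrightarrow>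
     mirror_rotation n \<sigma> \<and>
     (\<forall>j < 2 * n. v j \<in> S3 \<and>
        v ((j + 1) mod (2 * n)) = \<sigma> (v j) \<and>
        sph_dist (v j) (v ((j + 2) mod (2 * n))) = a \<and>
        sph_dist (v j) (v ((j + 1) mod (2 * n))) = c)"

end

theory Submission
  imports Defs
begin

text \<open>
  In suitable orthonormal coordinates of \<open>real^4\<close> the mirror-rotation is
  \<open>(x, y, z) \<mapsto> (x, - y, rot z)\<close> with \<open>x, y\<close> real, \<open>z\<close> in a plane and \<open>rot\<close> the plane rotation
  by \<open>\<theta> = \<pi> / n\<close>: the plane of the axis is spanned by a vector of the mirror hyperplane and the
  normal of the mirror, and the rotation acts on the orthogonal complement of that plane
  (\<open>frame_of_mirror_rotation\<close>, with converse \<open>mirror_rotation_of_frame\<close>).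

  The edge lengths then depend on a vertex only through its weights \<open>A = x\<^sup>2\<close>, \<open>B = y\<^sup>2\<close>,
  \<open>R = norm z ^ 2\<close>. Being on the sphere and having the prescribed distances to the first and
  the second image under the mirror-rotation amount to the linear system
  \<open>A + B + R = 1\<close>, \<open>A - B + R cos \<theta> = cos c\<close>, \<open>A + B + R cos (2 \<theta>) = cos a\<close>
  (\<open>frame_mirror_rotation_inner\<close>). Conversely, any nonnegative solution is realised
  by the orbit of \<open>(sqrt A, sqrt B, sqrt R, 0)\<close>, so an antiprism exists iff the
  system has a nonnegative solution (\<open>antiprism_exists_iff_weights\<close>).

  As \<open>\<bar>cos \<theta>\<bar> < 1\<close> for \<open>n \<ge> 2\<close>, the system has exactly one real solution, and the left-hand
  sides of the criterion are positive multiples of \<open>B\<close>, \<open>A\<close> and \<open>A + B\<close> in this order, while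
  \<open>R \<ge> 0\<close> is just \<open>cos a \<le> 1\<close> (\<open>weights_exist_iff\<close>).
\<close>

section \<open>Orthonormal frames\<close>

definition orthonormal_frame :: "real^4 \<Rightarrow> real^4 \<Rightarrow> real^4 \<Rightarrow> real^4 \<Rightarrow> bool" where
  "orthonormal_frame p q e f \<longleftrightarrow>
     p \<bullet> p = 1 \<and> q \<bullet> q = 1 \<and> e \<bullet> e = 1 \<and> f \<bullet> f = 1 \<and>
     p \<bullet> q = 0 \<and> p \<bullet> e = 0 \<and> p \<bullet> f = 0 \<and> q \<bullet> e = 0 \<and> q \<bullet> f = 0 \<and> e \<bullet> f = 0"

text \<open>
  In frame coordinates this is the linear map with matrix \<open>diag (1, -1, rotation by \<theta>)\<close>: \<open>p, q\<close>
  span the plane of the axis, \<open>q\<close> is normal to the mirror, and \<open>e, f\<close> span the plane that is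
  rotated.
\<close>

definition frame_mirror_rotation ::
    "real \<Rightarrow> real^4 \<Rightarrow> real^4 \<Rightarrow> real^4 \<Rightarrow> real^4 \<Rightarrow> real^4 \<Rightarrow> real^4" where
  "frame_mirror_rotation \<theta> p q e f x =
     (x \<bullet> p) *\<^sub>R p - (x \<bullet> q) *\<^sub>R q
     + (x \<bullet> e) *\<^sub>R (cos \<theta> *\<^sub>R e + sin \<theta> *\<^sub>R f)
     + (x \<bullet> f) *\<^sub>R (- sin \<theta> *\<^sub>R e + cos \<theta> *\<^sub>R f)"

lemma orthonormal_frame_inner:
  assumes "orthonormal_frame p q e f"
  shows "p \<bullet> p = 1" "q \<bullet> q = 1" "e \<bullet> e = 1" "f \<bullet> f = 1"
    "p \<bullet> q = 0" "p \<bullet> e = 0" "p \<bullet> f = 0" "q \<bullet> e = 0" "q \<bullet> f = 0" "e \<bullet> f = 0"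
    "q \<bullet> p = 0" "e \<bullet> p = 0" "f \<bullet> p = 0" "e \<bullet> q = 0" "f \<bullet> q = 0" "f \<bullet> e = 0"
  using assms by (auto simp: orthonormal_frame_def inner_commute)

text \<open>
  Four orthonormal vectors span the space, so the difference of the two sides, being orthogonal to
  all of them, is orthogonal to itself.
\<close>

lemma orthonormal_frame_expansion:
  assumes "orthonormal_frame p q e f"
  shows "x = (x \<bullet> p) *\<^sub>R p + (x \<bullet> q) *\<^sub>R q + (x \<bullet> e) *\<^sub>R e + (x \<bullet> f) *\<^sub>R f"
proof -
  note fr = orthonormal_frame_inner[OF assms]
  let ?B = "{p, q, e, f}"
  have distinct: "distinct [p, q, e, f]" using fr by auto
  have "pairwise orthogonal ?B"
    using fr by (auto simp: pairwise_def orthogonal_def)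
  moreover have "0 \<notin> ?B" using fr by auto
  ultimately have ind: "independent ?B" by (rule pairwise_orthogonal_independent)
  have "card ?B = 4" using distinct by simp
  then have "UNIV \<subseteq> span ?B"
    using card_ge_dim_independent[OF subset_UNIV ind] by simp
  moreover define y where
    "y = x - ((x \<bullet> p) *\<^sub>R p + (x \<bullet> q) *\<^sub>R q + (x \<bullet> e) *\<^sub>R e + (x \<bullet> f) *\<^sub>R f)"
  have "orthogonal y b" if "b \<in> ?B" for b
    using that fr by (auto simp: y_def orthogonal_def inner_diff_left inner_add_left)
  ultimately have "orthogonal y y"
    using orthogonal_to_span[of y ?B y] by blast
  then show ?thesis by (simp add: y_def orthogonal_def)
qed

lemma orthonormal_frame_pythagoras:
  assumes "orthonormal_frame p q e f"
  shows "x \<bullet> x = (x \<bullet> p)\<^sup>2 + (x \<bullet> q)\<^sup>2 + ((x \<bullet> e)\<^sup>2 + (x \<bullet> f)\<^sup>2)"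
proof -
  have "x \<bullet> x = x \<bullet> ((x \<bullet> p) *\<^sub>R p + (x \<bullet> q) *\<^sub>R q + (x \<bullet> e) *\<^sub>R e + (x \<bullet> f) *\<^sub>R f)"
    using orthonormal_frame_expansion[OF assms, of x] by simp
  then show ?thesis by (simp add: inner_add_right power2_eq_square)
qed

lemma orthonormal_frame_axis:
  "orthonormal_frame (axis 1 1) (axis 2 1) (axis 3 1) (axis 4 1)"
  by (simp add: orthonormal_frame_def inner_axis_axis)

section \<open>Normal form of a mirror-rotation\<close>

text \<open>
  Great circles and great 2-spheres are given as sections of the unit sphere; this recovers the
  linear subspace from the section.
\<close>

lemma span_subspace_Int_S3:
  assumes "subspace V"
  shows "span (V \<inter> S3) = V"
proof
  show "span (V \<inter> S3) \<subseteq> V"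
    using assms by (simp add: span_minimal)
  show "V \<subseteq> span (V \<inter> S3)"
  proof
    fix x assume x: "x \<in> V"
    show "x \<in> span (V \<inter> S3)"
    proof (cases "x = 0")
      case False
      then have "x /\<^sub>R norm x \<in> V \<inter> S3"
        using x assms by (simp add: subspace_scale S3_def)
      then have "norm x *\<^sub>R (x /\<^sub>R norm x) \<in> span (V \<inter> S3)"
        by (intro span_scale span_base)
      then show ?thesis using False by simp
    qed (simp add: span_zero)
  qed
qed

text \<open>
  For dimension reasons the plane \<open>P\<close> of the axis meets the mirror hyperplane \<open>H\<close> in a unit
  vector \<open>p\<close>. The perpendicularity of axis and mirror at the single point \<open>p\<close> already makes the
  unit vector \<open>q\<close> of \<open>P\<close> orthogonal to \<open>p\<close> a normal of \<open>H\<close>. Hence the reflection negates \<open>q\<close>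
  and fixes the complement of \<open>P\<close>, which is where the rotation takes place.
\<close>

lemma frame_of_mirror_rotation:
  assumes "mirror_rotation n \<sigma>"
  obtains p q e f where "orthonormal_frame p q e f"
    "\<sigma> = frame_mirror_rotation (pi / real n) p q e f"
proof -
  define \<theta> where "\<theta> = pi / real n"
  obtain C M \<rho> \<tau> where C: "great_circle C" and M: "great_two_sphere M"
    and perp: "perpendicular C M" and rho: "rotation_about C \<theta> \<rho>"
    and tau: "reflection_in M \<tau>" and sigma: "\<sigma> = \<tau> \<circ> \<rho>"
    using assms unfolding mirror_rotation_def \<theta>_def by blast
  obtain P where P: "subspace P" "dim P = 2" "C = P \<inter> S3"
    using C unfolding great_circle_def by blast
  obtain H where H: "subspace H" "dim H = 3" "M = H \<inter> S3"
    using M unfolding great_two_sphere_def by blast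
  have spanC: "span C = P" and spanM: "span M = H"
    using P H span_subspace_Int_S3 by simp_all
  have "dim {x + y |x y. x \<in> P \<and> y \<in> H} + dim (P \<inter> H) = 5"
    using dim_sums_Int[of P H] P H by simp
  moreover have "dim {x + y |x y. x \<in> P \<and> y \<in> H} \<le> 4"
    using dim_subset_UNIV[of "{x + y |x y. x \<in> P \<and> y \<in> H}"] by simp
  ultimately have "dim (P \<inter> H) \<noteq> 0" by linarith
  then obtain p0 where "p0 \<in> P" "p0 \<in> H" "p0 \<noteq> 0"
    by (metis Int_iff dim_eq_0 subsetI singletonI)
  moreover define p where "p = p0 /\<^sub>R norm p0"
  ultimately have p: "p \<in> P" "p \<in> H" "norm p = 1"
    using P H by (simp_all add: subspace_scale)
  have "\<not> P \<subseteq> span {p}"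
    using dim_subset[of P "span {p}"] P(2) dim_le_card[of "{p}" "{p}"] by (auto simp: span_superset)
  then obtain y where y: "y \<in> P" "y \<notin> span {p}" by blast
  define q0 where "q0 = y - (y \<bullet> p) *\<^sub>R p"
  have "q0 \<noteq> 0"
    using y(2) span_scale[OF span_base[of p "{p}"], of "y \<bullet> p"] by (auto simp: q0_def)
  moreover have "q0 \<in> P" using y p P by (simp add: q0_def subspace_diff subspace_scale)
  moreover have pp: "p \<bullet> p = 1" using p by (simp add: dot_square_norm)
  have "q0 \<bullet> p = 0" by (simp add: q0_def inner_diff_left pp)
  moreover define q where "q = q0 /\<^sub>R norm q0"
  ultimately have q: "q \<in> P" "norm q = 1" "q \<bullet> p = 0"
    using P by (simp_all add: subspace_scale)
  \<comment> \<open>Perpendicularity concerns only vectors tangent at \<open>p\<close>, so a vector of \<open>H\<close> is first projected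
      to the complement of \<open>p\<close>.\<close>
  have qH: "orthogonal q s" if "s \<in> H" for s
  proof -
    define s' where "s' = s - (s \<bullet> p) *\<^sub>R p"
    have "s' \<in> H" using that p H by (simp add: s'_def subspace_diff subspace_scale)
    moreover have "orthogonal s' p" by (simp add: s'_def orthogonal_def inner_diff_left pp)
    moreover have "orthogonal q p" "p \<in> C \<inter> M"
      using q p P H by (simp_all add: orthogonal_def S3_def)
    ultimately have "orthogonal q s'"
      using perp q unfolding perpendicular_def spanC spanM by blast
    then show ?thesis using q(3) by (simp add: s'_def orthogonal_def inner_diff_right)
  qed
  have H_eq: "H = {x. q \<bullet> x = 0}"
  proof (rule subspace_dim_equal)
    show "H \<subseteq> {x. q \<bullet> x = 0}" using qH by (auto simp: orthogonal_def)
    have "q \<noteq> 0" using q by auto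
    then show "dim H \<ge> dim {x. q \<bullet> x = 0}" using H by (simp add: dim_hyperplane)
  qed (simp_all add: H subspace_hyperplane)
  obtain e f where ef: "e \<in> orthogonal_comp P" "f \<in> orthogonal_comp P"
      "norm e = 1" "norm f = 1" "orthogonal e f"
    and rho_ef: "\<rho> e = cos \<theta> *\<^sub>R e + sin \<theta> *\<^sub>R f" "\<rho> f = - sin \<theta> *\<^sub>R e + cos \<theta> *\<^sub>R f"
    using rho unfolding rotation_about_def spanC by blast
  have perp_ef: "p \<bullet> e = 0" "p \<bullet> f = 0" "q \<bullet> e = 0" "q \<bullet> f = 0"
    using ef p q by (simp_all add: orthogonal_comp_def orthogonal_def)
  have frame: "orthonormal_frame p q e f"
    using p q ef perp_ef
    by (simp add: orthonormal_frame_def dot_square_norm inner_commute orthogonal_def)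
  have rho_pq: "\<rho> p = p" "\<rho> q = q"
    using rho p q by (simp_all add: rotation_about_def spanC)
  have tau_H: "\<tau> s = s" if "s \<in> H" for s
    using tau that by (simp add: reflection_in_def spanM)
  have tau_q: "\<tau> q = - q"
    using tau qH by (simp add: reflection_in_def spanM orthogonal_comp_def orthogonal_commute)
  have "e \<in> H" "f \<in> H" using perp_ef by (simp_all add: H_eq)
  then have tau_pef: "\<tau> p = p" "\<tau> e = e" "\<tau> f = f" using p tau_H by simp_all
  have lin: "linear \<tau>" "linear \<rho>" using tau rho by (simp_all add: reflection_in_def rotation_about_def)
  have "\<sigma> x = frame_mirror_rotation \<theta> p q e f x" for x
  proof -
    have "\<sigma> x = \<tau> (\<rho> ((x \<bullet> p) *\<^sub>R p + (x \<bullet> q) *\<^sub>R q + (x \<bullet> e) *\<^sub>R e + (x \<bullet> f) *\<^sub>R f))"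
      using orthonormal_frame_expansion[OF frame, of x] sigma by simp
    then show ?thesis
      by (simp only: linear_add[OF lin(1)] linear_add[OF lin(2)] linear_scale[OF lin(1)]
          linear_scale[OF lin(2)] rho_pq rho_ef tau_pef tau_q frame_mirror_rotation_def
          scaleR_minus_right add_uminus_conv_diff)
  qed
  then show ?thesis using that frame unfolding \<theta>_def by blast
qed

text \<open>
  The axis is cut out by \<open>span {p, q}\<close> and the mirror by \<open>span {p, e, f}\<close>. They meet only in
  multiples of \<open>p\<close>, where the tangent direction \<open>q\<close> of the axis is the normal of the mirror.
\<close>

lemma mirror_rotation_of_frame:
  assumes frame: "orthonormal_frame p q e f"
  shows "mirror_rotation n (frame_mirror_rotation (pi / real n) p q e f)"
proof -
  note fr = orthonormal_frame_inner[OF frame]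
  define \<theta> where "\<theta> = pi / real n"
  define P where "P = span {p, q}"
  define H where "H = span {p, e, f}"
  define \<rho> where "\<rho> x = (x \<bullet> p) *\<^sub>R p + (x \<bullet> q) *\<^sub>R q
     + (x \<bullet> e) *\<^sub>R (cos \<theta> *\<^sub>R e + sin \<theta> *\<^sub>R f)
     + (x \<bullet> f) *\<^sub>R (- sin \<theta> *\<^sub>R e + cos \<theta> *\<^sub>R f)" for x
  define \<tau> where "\<tau> x = x - (2 * (x \<bullet> q)) *\<^sub>R q" for x :: "real^4"
  have double: "(2 * t) *\<^sub>R q = t *\<^sub>R q + t *\<^sub>R q" for t
    by (simp flip: scaleR_left_distrib)
  have nz: "p \<noteq> 0" "q \<noteq> 0" "e \<noteq> 0" "f \<noteq> 0" using fr by auto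
  have ne: "p \<noteq> q" "p \<noteq> e" "p \<noteq> f" "e \<noteq> f" using fr by auto
  have "independent {p, q}" "independent {p, e, f}"
    using fr nz
    by (intro pairwise_orthogonal_independent; auto simp: pairwise_def orthogonal_def)+
  then have dims: "dim P = 2" "dim H = 3"
    using ne by (simp_all add: P_def H_def dim_eq_card_independent)
  have sub: "subspace P" "subspace H" by (simp_all add: P_def H_def)
  define C where "C = P \<inter> S3"
  define M where "M = H \<inter> S3"
  have spanC: "span C = P" and spanM: "span M = H"
    using sub by (simp_all add: C_def M_def span_subspace_Int_S3)
  have pqef: "p \<in> P" "q \<in> P" "p \<in> H" "e \<in> H" "f \<in> H"
    by (simp_all add: P_def H_def span_base)
  have P_perp: "x \<bullet> e = 0 \<and> x \<bullet> f = 0" if "x \<in> P" for x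
  proof -
    have "orthogonal e x"
      by (rule orthogonal_to_span[OF that[unfolded P_def]]) (use fr in \<open>auto simp: orthogonal_def\<close>)
    moreover have "orthogonal f x"
      by (rule orthogonal_to_span[OF that[unfolded P_def]]) (use fr in \<open>auto simp: orthogonal_def\<close>)
    ultimately show ?thesis by (simp add: orthogonal_def inner_commute)
  qed
  have H_perp: "x \<bullet> q = 0" if "x \<in> H" for x
  proof -
    have "orthogonal q x"
      by (rule orthogonal_to_span[OF that[unfolded H_def]]) (use fr in \<open>auto simp: orthogonal_def\<close>)
    then show ?thesis by (simp add: orthogonal_def inner_commute)
  qed
  have "great_circle C" "great_two_sphere M"
    using sub dims by (auto simp: great_circle_def great_two_sphere_def C_def M_def)
  moreover have "perpendicular C M"
    unfolding perpendicular_def spanC spanM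
  proof (intro ballI impI)
    fix z t s assume z: "z \<in> C \<inter> M" and t: "t \<in> P" "orthogonal t z" and s: "s \<in> H"
    have "z \<bullet> e = 0" "z \<bullet> f = 0" "z \<bullet> q = 0"
      using z P_perp H_perp by (auto simp: C_def M_def)
    then have zp: "z = (z \<bullet> p) *\<^sub>R p"
      using orthonormal_frame_expansion[OF frame, of z] by simp
    moreover have "z \<noteq> 0" using z by (auto simp: C_def S3_def)
    ultimately have "z \<bullet> p \<noteq> 0" by auto
    moreover have "(z \<bullet> p) * (t \<bullet> p) = 0"
      using t(2) zp by (metis orthogonal_def inner_scaleR_right)
    ultimately have "t \<bullet> p = 0" by simp
    then have "t = (t \<bullet> q) *\<^sub>R q"
      using orthonormal_frame_expansion[OF frame, of t] P_perp[OF t(1)] by simp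
    then have "t \<bullet> s = (t \<bullet> q) * (s \<bullet> q)" by (metis inner_commute inner_scaleR_left)
    then show "orthogonal t s" using H_perp[OF s] by (simp add: orthogonal_def)
  qed
  moreover have "rotation_about C \<theta> \<rho>"
    unfolding rotation_about_def spanC
  proof (intro conjI exI ballI)
    show "linear \<rho>"
      by (rule linearI) (simp_all add: \<rho>_def algebra_simps)
    show "\<rho> x = x" if "x \<in> P" for x
      using orthonormal_frame_expansion[OF frame, of x] P_perp[OF that] by (simp add: \<rho>_def)
    show "e \<in> orthogonal_comp P" "f \<in> orthogonal_comp P"
      using P_perp by (auto simp: orthogonal_comp_def orthogonal_def)
    show "norm e = 1" "norm f = 1" using fr by (simp_all add: norm_eq_1)
    show "orthogonal e f" using fr by (simp add: orthogonal_def)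
    show "\<rho> e = cos \<theta> *\<^sub>R e + sin \<theta> *\<^sub>R f" "\<rho> f = - sin \<theta> *\<^sub>R e + cos \<theta> *\<^sub>R f"
      using fr by (simp_all add: \<rho>_def)
  qed
  moreover have "reflection_in M \<tau>"
    unfolding reflection_in_def spanM
  proof (intro conjI ballI)
    show "linear \<tau>"
      by (rule linearI) (simp_all add: \<tau>_def algebra_simps)
    show "\<tau> x = x" if "x \<in> H" for x using H_perp[OF that] by (simp add: \<tau>_def)
    show "\<tau> x = - x" if "x \<in> orthogonal_comp H" for x
    proof -
      have "x \<bullet> p = 0" "x \<bullet> e = 0" "x \<bullet> f = 0"
        using that pqef by (auto simp: orthogonal_comp_def orthogonal_def inner_commute)
      then have "x = (x \<bullet> q) *\<^sub>R q" using orthonormal_frame_expansion[OF frame, of x] by simp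
      moreover have "\<tau> (k *\<^sub>R q) = - (k *\<^sub>R q)" for k
        by (simp add: \<tau>_def fr double)
      ultimately show ?thesis by metis
    qed
  qed
  moreover have "frame_mirror_rotation \<theta> p q e f = \<tau> \<circ> \<rho>"
  proof
    fix x
    have "\<rho> x \<bullet> q = x \<bullet> q" by (simp add: \<rho>_def fr inner_add_left inner_diff_left)
    then show "frame_mirror_rotation \<theta> p q e f x = (\<tau> \<circ> \<rho>) x"
      by (simp add: \<tau>_def double) (simp add: \<rho>_def frame_mirror_rotation_def)
  qed
  ultimately show ?thesis unfolding mirror_rotation_def \<theta>_def by blast
qed

section \<open>Distances in terms of the weights of a vertex\<close>

text \<open>
  The cosine of the distance from a point of the sphere to its first or second image. The square of
  the mirror-rotation fixes \<open>q\<close>, whence the plus sign in the second equation.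
\<close>

lemma frame_mirror_rotation_inner:
  fixes \<theta> :: real
  assumes "orthonormal_frame p q e f"
  defines "\<sigma> \<equiv> frame_mirror_rotation \<theta> p q e f"
  shows "x \<bullet> \<sigma> x = (x \<bullet> p)\<^sup>2 - (x \<bullet> q)\<^sup>2 + ((x \<bullet> e)\<^sup>2 + (x \<bullet> f)\<^sup>2) * cos \<theta>" (is ?one)
    and "x \<bullet> \<sigma> (\<sigma> x) = (x \<bullet> p)\<^sup>2 + (x \<bullet> q)\<^sup>2 + ((x \<bullet> e)\<^sup>2 + (x \<bullet> f)\<^sup>2) * cos (2 * \<theta>)" (is ?two)
proof -
  note fr = orthonormal_frame_inner[OF assms(1)]
  show ?one
    by (simp add: \<sigma>_def frame_mirror_rotation_def inner_add_right inner_diff_right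
        power2_eq_square algebra_simps)
  have comp: "\<sigma> x \<bullet> p = x \<bullet> p" "\<sigma> x \<bullet> q = - (x \<bullet> q)"
    "\<sigma> x \<bullet> e = cos \<theta> * (x \<bullet> e) - sin \<theta> * (x \<bullet> f)"
    "\<sigma> x \<bullet> f = sin \<theta> * (x \<bullet> e) + cos \<theta> * (x \<bullet> f)"
    by (simp_all add: \<sigma>_def frame_mirror_rotation_def inner_add_left inner_diff_left fr)
  have "x \<bullet> \<sigma> (\<sigma> x) = (\<sigma> x \<bullet> p) * (x \<bullet> p) - (\<sigma> x \<bullet> q) * (x \<bullet> q)
      + (\<sigma> x \<bullet> e) * (cos \<theta> * (x \<bullet> e) + sin \<theta> * (x \<bullet> f))
      + (\<sigma> x \<bullet> f) * (- sin \<theta> * (x \<bullet> e) + cos \<theta> * (x \<bullet> f))"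
    by (simp add: \<sigma>_def frame_mirror_rotation_def[of _ _ _ _ _ "frame_mirror_rotation _ _ _ _ _ _"]
        inner_add_right inner_diff_right)
  then show ?two
    unfolding cos_double comp by (simp add: power2_eq_square algebra_simps)
qed

text \<open>
  With \<open>k = cos \<theta>\<close>, \<open>w = cos c\<close>, \<open>u = cos a\<close> this decides when the linear system for the weights
  has a nonnegative solution. Subtracting the third equation from the first determines \<open>R\<close>, and
  then \<open>A + B\<close> and \<open>A - B\<close> are known; the coefficients are nonzero as \<open>\<bar>k\<bar> < 1\<close>.
\<close>

lemma weights_exist_iff:
  fixes k u w :: real
  assumes "-1 < k" "k < 1"
  shows "(\<exists>A B R. A \<ge> 0 \<and> B \<ge> 0 \<and> R \<ge> 0 \<and> A + B + R = 1 \<and>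
            A - B + R * k = w \<and> A + B + R * (2 * k\<^sup>2 - 1) = u) \<longleftrightarrow>
         u \<le> 1 \<and> 1 + u - 2 * (1 + k) * w + 2 * k \<ge> 0 \<and>
         1 + u + 2 * (1 - k) * w - 2 * k \<ge> 0 \<and> u - (2 * k\<^sup>2 - 1) \<ge> 0"
    (is "?L \<longleftrightarrow> ?R")
proof
  assume ?L
  then obtain A B R where nn: "A \<ge> 0" "B \<ge> 0" "R \<ge> 0" and sum: "A + B + R = 1"
    and wu: "A - B + R * k = w" "A + B + R * (2 * k\<^sup>2 - 1) = u" by blast
  have eq: "w = A - B + R * k" "u = A + B + R * (2 * k\<^sup>2 - 1)" "A = 1 - B - R"
    using wu sum by simp_all
  have k2: "k\<^sup>2 \<le> 1" using assms by (simp add: abs_square_le_1)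
  have "1 - u = 2 * (R * (1 - k\<^sup>2))" "u - (2 * k\<^sup>2 - 1) = 2 * ((A + B) * (1 - k\<^sup>2))"
    "1 + u - 2 * (1 + k) * w + 2 * k = 4 * (B * (1 + k))"
    "1 + u + 2 * (1 - k) * w - 2 * k = 4 * (A * (1 - k))"
    unfolding eq by (simp_all add: power2_eq_square algebra_simps)
  moreover have "R * (1 - k\<^sup>2) \<ge> 0" "(A + B) * (1 - k\<^sup>2) \<ge> 0" "B * (1 + k) \<ge> 0" "A * (1 - k) \<ge> 0"
    using nn k2 assms by simp_all
  ultimately show ?R by linarith
next
  assume R: ?R
  \<comment> \<open>the unique solution of the linear system\<close>
  define A where "A = (1 + u + 2 * (1 - k) * w - 2 * k) / (4 * (1 - k))"
  define B where "B = (1 + u - 2 * (1 + k) * w + 2 * k) / (4 * (1 + k))"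
  define R where "R = (1 - u) / (2 * (1 - k\<^sup>2))"
  have k2: "k\<^sup>2 < 1" using assms by (simp add: abs_square_less_1)
  have "A \<ge> 0" "B \<ge> 0" "R \<ge> 0" using R assms k2 by (simp_all add: A_def B_def R_def)
  moreover have "1 - k\<^sup>2 = (1 - k) * (1 + k)" by (simp add: power2_eq_square algebra_simps)
  then have R_eq: "R = (1 - u) / (2 * ((1 - k) * (1 + k)))" by (simp add: R_def)
  have nz: "1 - k \<noteq> 0" "1 + k \<noteq> 0" using assms by auto
  have "A + B + R = 1" "A - B + R * k = w" "A + B + R * (2 * k\<^sup>2 - 1) = u"
    unfolding A_def B_def R_eq using nz by (simp_all add: divide_simps) algebra+
  ultimately show ?L by blast
qed

section \<open>Existence of antiprisms\<close>

text \<open>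
  The weights do not change along an orbit, so all vertices impose the same equations and it is
  enough to read them off at \<open>v 0\<close>. Conversely the orbit of \<open>(sqrt A, sqrt B, sqrt R, 0)\<close> closes up after \<open>2 n\<close>
  steps: the sign of the \<open>q\<close>-coordinate has period 2 and the total rotation angle is \<open>2 \<pi>\<close>.
\<close>

lemma antiprism_exists_iff_weights:
  fixes n :: nat and a c :: real
  assumes n: "n \<ge> 2" and a: "a \<in> {0..pi}" and c: "c \<in> {0..pi}"
  shows "(\<exists>\<sigma> v. spherical_antiprism n a c \<sigma> v) \<longleftrightarrow>
    (\<exists>A B R. A \<ge> 0 \<and> B \<ge> 0 \<and> R \<ge> 0 \<and> A + B + R = 1 \<and>
       A - B + R * cos (pi / real n) = cos c \<and> A + B + R * cos (2 * (pi / real n)) = cos a)"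
    (is "?L \<longleftrightarrow> ?R")
proof
  assume ?L
  then obtain \<sigma> v where "spherical_antiprism n a c \<sigma> v" by blast
  then have mr: "mirror_rotation n \<sigma>" and
    v: "\<And>j. j < 2 * n \<Longrightarrow> v j \<in> S3 \<and> v ((j + 1) mod (2 * n)) = \<sigma> (v j) \<and>
        sph_dist (v j) (v ((j + 2) mod (2 * n))) = a \<and>
        sph_dist (v j) (v ((j + 1) mod (2 * n))) = c"
    unfolding spherical_antiprism_def by blast+
  obtain p q e f where frame: "orthonormal_frame p q e f"
    and sigma: "\<sigma> = frame_mirror_rotation (pi / real n) p q e f"
    using frame_of_mirror_rotation[OF mr] by blast
  have v12: "v 1 = \<sigma> (v 0)" "v 2 = \<sigma> (v 1)" and S3: "v 0 \<in> S3" "v 1 \<in> S3" "v 2 \<in> S3"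
    and d: "sph_dist (v 0) (v 1) = c" "sph_dist (v 0) (v 2) = a"
    using v[of 0] v[of 1] v[of 2] n by (auto simp: numeral_2_eq_2)
  have "cos (sph_dist x y) = x \<bullet> y" if "x \<in> S3" "y \<in> S3" for x y
    using that Cauchy_Schwarz_ineq2[of x y] by (simp add: sph_dist_def S3_def cos_arccos_abs)
  then have "v 0 \<bullet> \<sigma> (v 0) = cos c" "v 0 \<bullet> \<sigma> (\<sigma> (v 0)) = cos a"
    using v12 S3 d by metis+
  moreover have "v 0 \<bullet> v 0 = 1" using S3 by (simp add: S3_def dot_square_norm)
  ultimately show ?R
    using orthonormal_frame_pythagoras[OF frame, of "v 0"]
      frame_mirror_rotation_inner[OF frame, where \<theta> = "pi / real n" and x = "v 0", folded sigma]
    by (intro exI[of _ "(v 0 \<bullet> p)\<^sup>2"] exI[of _ "(v 0 \<bullet> q)\<^sup>2"] exI[of _ "(v 0 \<bullet> e)\<^sup>2 + (v 0 \<bullet> f)\<^sup>2"]) simp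
next
  assume ?R
  then obtain A B R where nn: "A \<ge> 0" "B \<ge> 0" "R \<ge> 0" and sum: "A + B + R = 1"
    and cc: "A - B + R * cos (pi / real n) = cos c"
    and ca: "A + B + R * cos (2 * (pi / real n)) = cos a" by blast
  define \<theta> where "\<theta> = pi / real n"
  obtain p q e f where frame: "orthonormal_frame p q e f"
    using orthonormal_frame_axis by blast
  note fr = orthonormal_frame_inner[OF frame]
  define \<sigma> where "\<sigma> = frame_mirror_rotation \<theta> p q e f"
  define v where "v j = sqrt A *\<^sub>R p + ((-1) ^ j * sqrt B) *\<^sub>R q
      + (sqrt R * cos (real j * \<theta>)) *\<^sub>R e + (sqrt R * sin (real j * \<theta>)) *\<^sub>R f" for j
  have comp: "v j \<bullet> p = sqrt A" "v j \<bullet> q = (-1) ^ j * sqrt B"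
    "v j \<bullet> e = sqrt R * cos (real j * \<theta>)" "v j \<bullet> f = sqrt R * sin (real j * \<theta>)" for j
    by (simp_all add: v_def inner_add_left fr)
  have weights: "(v j \<bullet> p)\<^sup>2 = A" "(v j \<bullet> q)\<^sup>2 = B" "(v j \<bullet> e)\<^sup>2 + (v j \<bullet> f)\<^sup>2 = R" for j
  proof -
    have "((- 1) ^ j)\<^sup>2 = (1::real)" by (metis power_even_eq power_minus1_even)
    then show "(v j \<bullet> p)\<^sup>2 = A" "(v j \<bullet> q)\<^sup>2 = B" using nn by (simp_all add: comp power_mult_distrib)
    have "(v j \<bullet> e)\<^sup>2 + (v j \<bullet> f)\<^sup>2 = R * ((cos (real j * \<theta>))\<^sup>2 + (sin (real j * \<theta>))\<^sup>2)"
      using nn unfolding comp distrib_left by (simp only: power_mult_distrib real_sqrt_pow2)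
    then show "(v j \<bullet> e)\<^sup>2 + (v j \<bullet> f)\<^sup>2 = R" by simp
  qed
  have step: "\<sigma> (v j) = v (Suc j)" for j
    by (simp add: \<sigma>_def frame_mirror_rotation_def comp v_def[of "Suc j"] cos_add sin_add
        algebra_simps)
  have "real (j + 2 * n) * \<theta> = real j * \<theta> + 2 * pi" for j
    using n by (simp add: \<theta>_def divide_simps) (simp add: algebra_simps)
  then have period1: "v (j + 2 * n) = v j" for j
    by (simp only: v_def) (simp add: power_add)
  have "v (j + 2 * n * k) = v j" for j k
  proof (induction k)
    case (Suc k)
    have "j + 2 * n * Suc k = (j + 2 * n * k) + 2 * n" by simp
    then show ?case using Suc period1 by metis
  qed simp
  then have period: "v (j mod (2 * n)) = v j" for j
    by (metis mod_mult_div_eq)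
  have "v j \<in> S3" for j
    using orthonormal_frame_pythagoras[OF frame, of "v j"] weights[of j] sum
    by (simp add: S3_def norm_eq_1)
  moreover have "sph_dist (v j) (v (j + 1)) = c" for j
    using frame_mirror_rotation_inner(1)[OF frame, where \<theta> = \<theta> and x = "v j", folded \<sigma>_def] weights[of j] cc c
    by (simp add: step sph_dist_def arccos_cos \<theta>_def)
  moreover have "sph_dist (v j) (v (j + 2)) = a" for j
    using frame_mirror_rotation_inner(2)[OF frame, where \<theta> = \<theta> and x = "v j", folded \<sigma>_def] weights[of j] ca a
    by (simp add: step sph_dist_def arccos_cos \<theta>_def)
  moreover have "mirror_rotation n \<sigma>"
    using mirror_rotation_of_frame[OF frame] by (simp add: \<sigma>_def \<theta>_def)
  ultimately have "spherical_antiprism n a c \<sigma> v"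
    unfolding spherical_antiprism_def by (simp only: period) (simp add: step)
  then show ?L by blast
qed

theorem theorem3:
  fixes n :: nat and a c :: real
  assumes "n \<ge> 2" and "a \<in> {0..pi}" and "c \<in> {0..pi}"
  shows "(\<exists>\<sigma> v. spherical_antiprism n a c \<sigma> v) \<longleftrightarrow>
    (1 + cos a - 2 * (1 + cos (pi / real n)) * cos c + 2 * cos (pi / real n) \<ge> 0 \<and>
     1 + cos a + 2 * (1 - cos (pi / real n)) * cos c - 2 * cos (pi / real n) \<ge> 0 \<and>
     cos a - cos (2 * pi / real n) \<ge> 0)"
proof -
  have "0 < pi / real n" "pi / real n < pi"
    using assms(1) by (simp_all add: divide_less_eq)
  then have "cos (pi / real n) < 1" "-1 < cos (pi / real n)"
    using cos_monotone_0_pi[of 0 "pi / real n"] cos_monotone_0_pi[of "pi / real n" pi] by simp_all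
  note weights = weights_exist_iff[OF this(2,1), of "cos c" "cos a"]
  have "2 * pi / real n = 2 * (pi / real n)" by simp
  then show ?thesis
    unfolding antiprism_exists_iff_weights[OF assms] by (simp only: cos_double_cos weights cos_le_one simp_thms)
qed

end
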